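(* For all integers $0<m<n$, $$d_{\mathrm{GH}}(\mathbb{S}^m,\mathbb{S}^n)\geq \tfrac{1}{2}\zeta_m,\qquad\text{where }\zeta_m:=\arccos\left(\frac{-1}{m+1}\right).$$ Moreover, for any map $\varphi:\mathbb{S}^n\to\mathbb{S}^m$ (not necessarily continuous), $\operatorname{dis}(\varphi)\geq \zeta_m$.
   Context: For an integer $m\ge 0$, $\mathbb{S}^m=\{x\in\mathbb{R}^{m+1}:\|x\|=1\}$ is the unit sphere with the geodesic distance $d_{\mathbb{S}^m}(x,x')=\arccos\langle x,x'\rangle$. The Gromov-Hausdorff distance between bounded metric spaces $X,Y$ is $d_{\mathrm{GH}}(X,Y)=\inf d_{\mathrm{H}}(f(X),g(Y))$, the infimum being over all metric spaces $Z$ and all isometric (distance-preserving) embeddings $f:X\to Z$, $g:Y\to Z$, with $d_{\mathrm{H}}$ the Hausdorff distance in $Z$. Equivalently $d_{\mathrm{GH}}(X,Y)=\frac12\inf_R \operatorname{dis}(R)$, where $R\subseteq X\times Y$ ranges over correspondences (relations whose projections to $X$ and to $Y$ are both surjective) and $\operatorname{dis}(R)=\sup_{(x,y),(x',y')\in R}|d_X(x,x')-d_Y(y,y')|$. For a map $\varphi:X\to Y$ of metric spaces, $\operatorname{dis}(\varphi)=\sup_{x,x'\in X}|d_X(x,x')-d_Y(\varphi(x),\varphi(x'))|$ is the distortion of its graph. *)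

theory Defs
  imports "HOL-Analysis.Analysis"
begin

section \<open>Hausdorff and Gromov-Hausdorff distance\<close>

text \<open>
  Distances between sets and spaces take values in \<^typ>\<open>ereal\<close>, so that suprema and infima
  never need side conditions. On nonempty bounded sets they agree with the real-valued notions.
\<close>

definition hausdorff_dist :: "'a metric \<Rightarrow> 'a set \<Rightarrow> 'a set \<Rightarrow> ereal" where
  "hausdorff_dist Z A B =
     max (SUP a\<in>A. INF b\<in>B. ereal (mdist Z a b)) (SUP b\<in>B. INF a\<in>A. ereal (mdist Z a b))"

definition isometric_embedding :: "'a metric \<Rightarrow> 'b metric \<Rightarrow> ('a \<Rightarrow> 'b) \<Rightarrow> bool" where
  "isometric_embedding X Z f \<longleftrightarrow>
     f \<in> mspace X \<rightarrow> mspace Z \<and>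
     (\<forall>x\<in>mspace X. \<forall>x'\<in>mspace X. mdist Z (f x) (f x') = mdist X x x')"

text \<open>
  A definition cannot range over metric spaces \<open>Z\<close> of all types. Ranging over the metric spaces
  whose points lie in \<^typ>\<open>'a + 'b\<close> loses nothing: \<open>Z\<close> may be replaced by the union of
  the two images, which injects into this type. See \<open>gh_dist_le_hausdorff_dist\<close> below, where \<open>Z\<close>
  has an arbitrary type.
\<close>

definition gh_dist :: "'a metric \<Rightarrow> 'b metric \<Rightarrow> ereal" where
  "gh_dist X Y =
     Inf {hausdorff_dist Z (f ` mspace X) (g ` mspace Y) | (Z :: ('a + 'b) metric) f g.
            isometric_embedding X Z f \<and> isometric_embedding Y Z g}"

lemma gh_dist_le_hausdorff_dist:
  fixes X :: "'a metric" and Y :: "'b metric" and Z :: "'c metric"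
  assumes f: "isometric_embedding X Z f" and g: "isometric_embedding Y Z g"
  shows "gh_dist X Y \<le> hausdorff_dist Z (f ` mspace X) (g ` mspace Y)"
proof -
  define C where "C = f ` mspace X \<union> g ` mspace Y"
  define k :: "'c \<Rightarrow> 'a + 'b" where
    "k z = (if z \<in> f ` mspace X then Inl (inv_into (mspace X) f z)
            else Inr (inv_into (mspace Y) g z))" for z
  have inj: "inj_on k C"
    by (rule inj_onI) (auto simp: k_def C_def split: if_splits dest: inv_into_injective)
  have CZ: "C \<subseteq> mspace Z"
    using f g by (auto simp: C_def isometric_embedding_def)
  define d where "d u v = (if u \<in> k ` C \<and> v \<in> k ` C
      then mdist Z (inv_into C k u) (inv_into C k v) else 0)" for u v
  have d: "d (k a) (k b) = mdist Z a b" if "a \<in> C" "b \<in> C" for a b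
    using that inj by (auto simp: d_def)
  have met: "Metric_space (k ` C) d"
  proof
    show "0 \<le> d x y" for x y
      by (auto simp: d_def)
    show "d x y = d y x" for x y
      by (auto simp: d_def mdist_commute)
    show "d x y = 0 \<longleftrightarrow> x = y" if "x \<in> k ` C" "y \<in> k ` C" for x y
      using that CZ inj by (auto simp: d subset_iff inj_on_eq_iff)
    show "d x z \<le> d x y + d y z" if "x \<in> k ` C" "y \<in> k ` C" "z \<in> k ` C" for x y z
      using that CZ by (auto simp: d subset_iff intro!: mdist_triangle)
  qed
  define Z' where "Z' = metric (k ` C, d)"
  have Z': "mspace Z' = k ` C" "mdist Z' = d"
    by (auto simp: Z'_def Metric_space.mspace_metric[OF met] Metric_space.mdist_metric[OF met])
  have emb: "isometric_embedding X Z' (k \<circ> f)" "isometric_embedding Y Z' (k \<circ> g)"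
    using f g by (auto simp: isometric_embedding_def Z' d C_def)
  have eq: "hausdorff_dist Z' ((k \<circ> f) ` mspace X) ((k \<circ> g) ` mspace Y) =
            hausdorff_dist Z (f ` mspace X) (g ` mspace Y)"
    unfolding hausdorff_dist_def image_image Z' comp_def
    by (intro arg_cong2[where f = max] SUP_cong INF_cong refl) (auto simp: d C_def)
  show ?thesis
    unfolding gh_dist_def eq[symmetric] by (rule Inf_lower) (use emb in blast)
qed

definition distortion :: "'a metric \<Rightarrow> 'b metric \<Rightarrow> ('a \<Rightarrow> 'b) \<Rightarrow> ereal" where
  "distortion X Y \<phi> =
     (SUP x\<in>mspace X. SUP x'\<in>mspace X. ereal \<bar>mdist X x x' - mdist Y (\<phi> x) (\<phi> x')\<bar>)"

section \<open>Spheres with the geodesic distance\<close>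

text \<open>
  The points of \<^term>\<open>nsphere m\<close> are the functions \<^typ>\<open>nat \<Rightarrow> real\<close> supported on \<open>{..m}\<close> with
  \<open>(\<Sum>i\<le>m. (x i)\<^sup>2) = 1\<close>, that is, the unit vectors of a Euclidean space of dimension \<open>m + 1\<close>.
  The locale \<^locale>\<open>Metric_space\<close> requires distances to be nonnegative off the carrier as well,
  where \<^const>\<open>arccos\<close> need not be, hence the case distinction.
\<close>

definition geodesic_dist :: "nat \<Rightarrow> (nat \<Rightarrow> real) \<Rightarrow> (nat \<Rightarrow> real) \<Rightarrow> real" where
  "geodesic_dist m x y =
     (if x \<in> topspace (nsphere m) \<and> y \<in> topspace (nsphere m)
      then arccos (\<Sum>i\<le>m. x i * y i) else 0)"

definition geodesic_sphere :: "nat \<Rightarrow> (nat \<Rightarrow> real) metric" where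
  "geodesic_sphere m = metric (topspace (nsphere m), geodesic_dist m)"

lemma topspace_nsphere_iff:
  "x \<in> topspace (nsphere m) \<longleftrightarrow> (\<Sum>i\<le>m. (x i)\<^sup>2) = 1 \<and> (\<forall>i>m. x i = 0)"
  by (simp add: nsphere)

lemma abs_inner_nsphere_le_1:
  assumes "x \<in> topspace (nsphere m)" "y \<in> topspace (nsphere m)"
  shows "\<bar>\<Sum>i\<le>m. x i * y i\<bar> \<le> 1"
proof -
  have "(\<Sum>i\<le>m. x i * y i)\<^sup>2 \<le> (\<Sum>i\<le>m. (x i)\<^sup>2) * (\<Sum>i\<le>m. (y i)\<^sup>2)"
    by (rule Cauchy_Schwarz_ineq_sum)
  then show ?thesis
    using assms by (simp add: topspace_nsphere_iff abs_square_le_1)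
qed

lemma arccos_inner_nsphere_eq_0_iff:
  assumes "x \<in> topspace (nsphere m)" "y \<in> topspace (nsphere m)"
  shows "arccos (\<Sum>i\<le>m. x i * y i) = 0 \<longleftrightarrow> x = y"
proof
  assume "arccos (\<Sum>i\<le>m. x i * y i) = 0"
  then have "(\<Sum>i\<le>m. x i * y i) = 1"
    using abs_inner_nsphere_le_1[OF assms] by (metis cos_arccos_abs cos_zero)
  then have "(\<Sum>i\<le>m. (x i - y i)\<^sup>2) = 0"
    using assms
    by (simp add: topspace_nsphere_iff power2_diff sum.distrib sum_subtractf mult.assoc
          flip: sum_distrib_left)
  then have "\<forall>i\<le>m. x i = y i"
    by (subst (asm) sum_nonneg_eq_0_iff) auto
  then show "x = y"
    using assms unfolding topspace_nsphere_iff by (metis ext linorder_not_le)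
next
  assume "x = y"
  then show "arccos (\<Sum>i\<le>m. x i * y i) = 0"
    using assms by (simp add: topspace_nsphere_iff flip: power2_eq_square)
qed

lemma arccos_inner_nsphere_triangle:
  assumes x: "x \<in> topspace (nsphere m)" and y: "y \<in> topspace (nsphere m)"
    and z: "z \<in> topspace (nsphere m)"
  shows "arccos (\<Sum>i\<le>m. x i * z i) \<le> arccos (\<Sum>i\<le>m. x i * y i) + arccos (\<Sum>i\<le>m. y i * z i)"
proof -
  define a where "a = (\<Sum>i\<le>m. x i * y i)"
  define b where "b = (\<Sum>i\<le>m. y i * z i)"
  define c where "c = (\<Sum>i\<le>m. x i * z i)"
  have bounds: "\<bar>a\<bar> \<le> 1" "\<bar>b\<bar> \<le> 1" "\<bar>c\<bar> \<le> 1"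
    unfolding a_def b_def c_def using x y z by (auto intro: abs_inner_nsphere_le_1)
  have norms: "(\<Sum>i\<le>m. x i * x i) = 1" "(\<Sum>i\<le>m. y i * y i) = 1" "(\<Sum>i\<le>m. z i * z i) = 1"
    using x y z by (auto simp: topspace_nsphere_iff power2_eq_square)
  have 1: "(\<Sum>i\<le>m. (x i - a * y i) * (z i - b * y i)) = c - a * b"
  proof -
    have "(\<Sum>i\<le>m. (x i - a * y i) * (z i - b * y i)) =
          (\<Sum>i\<le>m. x i * z i - b * (x i * y i) - a * (y i * z i) + a * b * (y i * y i))"
      by (intro sum.cong refl) (simp add: algebra_simps)
    also have "\<dots> = c - b * a - a * b + a * b * 1"
      by (simp only: sum.distrib sum_subtractf flip: sum_distrib_left)
         (simp add: norms flip: a_def b_def c_def)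
    finally show ?thesis by simp
  qed
  have 2: "(\<Sum>i\<le>m. (x i - a * y i)\<^sup>2) = 1 - a\<^sup>2"
  proof -
    have "(\<Sum>i\<le>m. (x i - a * y i)\<^sup>2) =
          (\<Sum>i\<le>m. x i * x i - 2 * a * (x i * y i) + a * a * (y i * y i))"
      by (intro sum.cong refl) (simp add: algebra_simps power2_eq_square)
    also have "\<dots> = 1 - 2 * a * a + a * a * 1"
      by (simp only: sum.distrib sum_subtractf flip: sum_distrib_left)
         (simp add: norms flip: a_def)
    finally show ?thesis by (simp add: power2_eq_square)
  qed
  have 3: "(\<Sum>i\<le>m. (z i - b * y i)\<^sup>2) = 1 - b\<^sup>2"
  proof -
    have "(\<Sum>i\<le>m. (z i - b * y i)\<^sup>2) =
          (\<Sum>i\<le>m. z i * z i - 2 * b * (y i * z i) + b * b * (y i * y i))"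
      by (intro sum.cong refl) (simp add: algebra_simps power2_eq_square)
    also have "\<dots> = 1 - 2 * b * b + b * b * 1"
      by (simp only: sum.distrib sum_subtractf flip: sum_distrib_left)
         (simp add: norms flip: b_def)
    finally show ?thesis by (simp add: power2_eq_square)
  qed
  have "(c - a * b)\<^sup>2 \<le> (1 - a\<^sup>2) * (1 - b\<^sup>2)"
    using Cauchy_Schwarz_ineq_sum[of "\<lambda>i. x i - a * y i" "\<lambda>i. z i - b * y i" "{..m}"]
    unfolding 1 2 3 .
  then have "\<bar>c - a * b\<bar> \<le> sqrt (1 - a\<^sup>2) * sqrt (1 - b\<^sup>2)"
    by (metis real_sqrt_abs real_sqrt_le_mono real_sqrt_mult)
  then have "a * b - sqrt (1 - a\<^sup>2) * sqrt (1 - b\<^sup>2) \<le> c"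
    by linarith
  then have cos_le: "cos (arccos a + arccos b) \<le> c"
    using bounds by (simp add: cos_add cos_arccos_abs sin_arccos_abs)
  have ranges: "0 \<le> arccos a" "0 \<le> arccos b" "arccos c \<le> pi"
    using bounds by (auto intro!: arccos_lbound arccos_ubound simp: abs_le_iff)
  have "arccos c \<le> arccos a + arccos b"
  proof (cases "arccos a + arccos b \<le> pi")
    case True
    then have "arccos c \<le> arccos (cos (arccos a + arccos b))"
      using cos_le bounds by (intro arccos_le_arccos) auto
    also have "\<dots> = arccos a + arccos b"
      using True ranges by (intro arccos_cos) auto
    finally show ?thesis .
  qed (use ranges in linarith)
  then show ?thesis
    by (simp add: a_def b_def c_def)
qed

lemma Metric_space_geodesic: "Metric_space (topspace (nsphere m)) (geodesic_dist m)"
proof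
  show "0 \<le> geodesic_dist m x y" for x y
    using abs_inner_nsphere_le_1[of x m y]
    by (auto simp: geodesic_dist_def intro!: arccos_lbound)
  show "geodesic_dist m x y = geodesic_dist m y x" for x y
    by (simp add: geodesic_dist_def mult.commute)
  show "geodesic_dist m x y = 0 \<longleftrightarrow> x = y"
    if "x \<in> topspace (nsphere m)" "y \<in> topspace (nsphere m)" for x y
    using that by (simp add: geodesic_dist_def arccos_inner_nsphere_eq_0_iff)
  show "geodesic_dist m x z \<le> geodesic_dist m x y + geodesic_dist m y z"
    if "x \<in> topspace (nsphere m)" "y \<in> topspace (nsphere m)" "z \<in> topspace (nsphere m)" for x y z
    using that by (simp add: geodesic_dist_def arccos_inner_nsphere_triangle)
qed

lemma mspace_geodesic_sphere [simp]: "mspace (geodesic_sphere m) = topspace (nsphere m)"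
  by (simp add: geodesic_sphere_def Metric_space.mspace_metric[OF Metric_space_geodesic])

lemma mdist_geodesic_sphere:
  assumes "x \<in> topspace (nsphere m)" "y \<in> topspace (nsphere m)"
  shows "mdist (geodesic_sphere m) x y = arccos (\<Sum>i\<le>m. x i * y i)"
  using assms
  by (simp add: geodesic_sphere_def Metric_space.mdist_metric[OF Metric_space_geodesic]
        geodesic_dist_def)

definition zeta :: "nat \<Rightarrow> real" where
  "zeta m = arccos (- 1 / (real m + 1))"

end

theory Submission
  imports Defs "HOL-Homology.Homology"
begin

text \<open>
  Lowering the dimension of a sphere without identifying antipodes forces discontinuities, and these
  cause distortion. The bound for arbitrary maps \<open>\<phi>\<close> from the \<open>n\<close>-sphere to the \<open>m\<close>-sphere implies the
  bound for the Gromov-Hausdorff distance, since embeddings at Hausdorff distance below \<open>r\<close> yield a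
  \<open>\<phi>\<close> of distortion at most \<open>2 * r\<close> by picking near points (\<open>hausdorff_dist_less_imp_choice\<close>).

  Restricting \<open>\<phi>\<close> to the sphere of dimension \<open>m + 1\<close>, keeping it on one point of each antipodal
  pair and extending it oddly does not increase the distortion, because passing to an antipode
  replaces every distance \<open>d\<close> by \<open>pi - d\<close> on both sides (\<open>zeta_le_real_distortion\<close>). For odd
  \<open>\<phi>\<close>, a quantitative Borsuk-Ulam theorem of Dubins and Schwarz (\<open>odd_map_discontinuity\<close>) gives
  arbitrarily close points whose images are at distance at least \<open>zeta m\<close>, so the distortion is at
  least \<open>zeta m\<close> minus any positive amount.

  To see the latter, average \<open>\<phi>\<close> with continuous weights over a finite symmetric net. The average is
  continuous and odd with \<open>m + 1\<close> real coordinates, so it vanishes somewhere by \<open>Borsuk_Ulam\<close>. The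
  net points with positive weight there lie close together, and \<open>0\<close> is a positive combination of
  their images. But unit vectors in dimension \<open>m + 1\<close> with pairwise inner products above
  \<open>- 1 / (m + 1)\<close>, that is, at distances below \<open>zeta m\<close>, have no vanishing positive combination
  (\<open>positive_combination_nonzero\<close>); the vertices of a regular simplex show that this bound is sharp.

  The Borsuk-Ulam theorem itself is proved with singular chains. As the \<open>k\<close>-sphere has no homology
  in positive degrees below \<open>k\<close>, there are chains \<open>c 0, ..., c k\<close>, starting with a point, where the
  boundary of each is the previous one plus or minus its antipodal image. If \<open>a j\<close> is
  the indicator of \<open>f j > 0\<close>, with ties broken oddly, let a simplex with vertices
  \<open>v 0, ..., v i\<close> count when \<open>a j\<close> differs at \<open>v j\<close> and \<open>v (j + 1)\<close> for every \<open>j < i\<close>. The signed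
  count over \<open>c i\<close> keeps its parity from one \<open>i\<close> to the next and is \<open>1\<close> for \<open>i = 0\<close>
  (\<open>odd_eval_sign_changes\<close>). This survives barycentric subdivision, so there is a counted
  \<open>k\<close>-simplex inside one member of any given open cover (\<open>open_cover_sign_changes\<close>). If \<open>f\<close>
  had no zero, the sets where some \<open>f j\<close> has constant sign would be a cover violating this. In
  cohomological terms, the \<open>k\<close>-th power of the characteristic class of the antipodal double
  cover is nonzero, but would factor into classes each vanishing on one of \<open>k\<close> sets covering the
  space.
\<close>

section \<open>Linear functionals on free abelian groups\<close>

definition frag_eval :: "('a \<Rightarrow> int) \<Rightarrow> ('a \<Rightarrow>\<^sub>0 int) \<Rightarrow> int" where
  "frag_eval h c = (\<Sum>x\<in>Poly_Mapping.keys c. Poly_Mapping.lookup c x * h x)"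

lemma frag_eval_0 [simp]: "frag_eval h 0 = 0"
  by (simp add: frag_eval_def)

lemma frag_eval_of [simp]: "frag_eval h (frag_of x) = h x"
  by (simp add: frag_eval_def)

lemma frag_eval_superset:
  assumes "finite A" "Poly_Mapping.keys c \<subseteq> A"
  shows "frag_eval h c = (\<Sum>x\<in>A. Poly_Mapping.lookup c x * h x)"
  unfolding frag_eval_def
  by (rule sum.mono_neutral_left) (use assms in \<open>auto simp: in_keys_iff\<close>)

lemma frag_eval_diff: "frag_eval h (a - b) = frag_eval h a - frag_eval h b"
proof -
  let ?A = "Poly_Mapping.keys a \<union> Poly_Mapping.keys b"
  have "frag_eval h (a - b) = (\<Sum>x\<in>?A. Poly_Mapping.lookup (a - b) x * h x)"
    by (rule frag_eval_superset) (use keys_diff[of a b] in auto)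
  also have "\<dots> = (\<Sum>x\<in>?A. Poly_Mapping.lookup a x * h x)
                 - (\<Sum>x\<in>?A. Poly_Mapping.lookup b x * h x)"
    by (simp add: lookup_minus left_diff_distrib sum_subtractf)
  also have "\<dots> = frag_eval h a - frag_eval h b"
    by (simp add: frag_eval_superset[of ?A])
  finally show ?thesis .
qed

lemma frag_eval_minus: "frag_eval h (- a) = - frag_eval h a"
  using frag_eval_diff[of h 0 a] by simp

lemma frag_eval_add: "frag_eval h (a + b) = frag_eval h a + frag_eval h b"
  using frag_eval_diff[of h a "- b"] by (simp add: frag_eval_minus)

lemma frag_eval_cmul: "frag_eval h (frag_cmul k c) = k * frag_eval h c"
proof -
  have "frag_eval h (frag_cmul k c) = (\<Sum>x\<in>Poly_Mapping.keys c. k * Poly_Mapping.lookup c x * h x)"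
    by (subst frag_eval_superset[of "Poly_Mapping.keys c"]) (simp_all add: keys_cmul)
  then show ?thesis
    by (simp add: frag_eval_def sum_distrib_left mult.assoc)
qed

lemma frag_eval_sum: "frag_eval h (\<Sum>i\<in>I. g i) = (\<Sum>i\<in>I. frag_eval h (g i))"
  by (induction I rule: infinite_finite_induct) (simp_all add: frag_eval_add)

lemma frag_eval_cong:
  "(\<And>x. x \<in> Poly_Mapping.keys c \<Longrightarrow> g x = h x) \<Longrightarrow> frag_eval g c = frag_eval h c"
  by (simp add: frag_eval_def)

lemma frag_eval_extend: "frag_eval h (frag_extend f c) = frag_eval (\<lambda>x. frag_eval h (f x)) c"
  by (simp add: frag_extend_def frag_eval_sum frag_eval_cmul) (simp add: frag_eval_def)

section \<open>Counting sign changes on singular chains\<close>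

definition delete_at :: "nat \<Rightarrow> (nat \<Rightarrow> 'a) \<Rightarrow> nat \<Rightarrow> 'a" where
  "delete_at k v = (\<lambda>j. if j < k then v j else v (Suc j))"

definition sign_changes :: "(nat \<Rightarrow> 'a \<Rightarrow> int) \<Rightarrow> nat \<Rightarrow> (nat \<Rightarrow> 'a) \<Rightarrow> int" where
  "sign_changes a i v = (\<Prod>j<i. a j (v (Suc j)) - a j (v j))"

lemma sign_changes_delete_last:
  "sign_changes a i (delete_at (Suc i) v) = sign_changes a i v"
  by (simp add: sign_changes_def delete_at_def)

text \<open>
  The Leibniz rule for the cup product. With \<open>w j\<close> the coboundary of the 0-cochain \<open>a j\<close>, sign
  changes are the product \<open>w 0 \<union> ... \<union> w (i - 1)\<close> of cocycles, so only the last factor of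
  \<open>w 0 \<union> ... \<union> w (i - 1) \<union> g\<close> contributes to the coboundary. In the induction a deletion among the
  first \<open>i + 2\<close> positions leaves the last vertex alone, which can therefore be absorbed into \<open>g\<close>;
  hence \<open>g\<close> is arbitrary.
\<close>
lemma coboundary_sign_changes:
  "(\<Sum>k\<le>Suc i. (-1) ^ k * (sign_changes a i (delete_at k v) * g (delete_at k v i))) =
   (-1) ^ i * sign_changes a i v * (g (v (Suc i)) - g (v i))"
proof (induction i arbitrary: g)
  case 0
  show ?case by (simp add: sign_changes_def delete_at_def)
next
  case (Suc i)
  let ?w = "v (Suc (Suc i))"
  have summand: "sign_changes a (Suc i) (delete_at k v) * g (delete_at k v (Suc i)) =
      sign_changes a i (delete_at k v) * ((a i ?w - a i (delete_at k v i)) * g ?w)"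
    if "k \<le> Suc i" for k
    using that by (auto simp: sign_changes_def delete_at_def)
  have "(\<Sum>k\<le>Suc i. (-1) ^ k * (sign_changes a (Suc i) (delete_at k v) * g (delete_at k v (Suc i)))) =
        (\<Sum>k\<le>Suc i. (-1) ^ k * (sign_changes a i (delete_at k v) * ((a i ?w - a i (delete_at k v i)) * g ?w)))"
    by (intro sum.cong refl) (simp add: summand)
  also have "\<dots> = (-1) ^ i * sign_changes a i v *
      ((a i ?w - a i (v (Suc i))) * g ?w - (a i ?w - a i (v i)) * g ?w)"
    by (rule Suc.IH)
  also have "\<dots> = (-1) ^ Suc i * sign_changes a (Suc i) v * g ?w"
    by (simp add: sign_changes_def algebra_simps)
  finally have first: "(\<Sum>k\<le>Suc i. (-1) ^ k *
        (sign_changes a (Suc i) (delete_at k v) * g (delete_at k v (Suc i)))) =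
      (-1) ^ Suc i * sign_changes a (Suc i) v * g ?w" .
  have last: "delete_at (Suc (Suc i)) v (Suc i) = v (Suc i)"
    by (simp add: delete_at_def)
  show ?case
    unfolding sum.atMost_Suc[of _ "Suc i"] first sign_changes_delete_last last
    by (simp add: algebra_simps)
qed

definition simplex_vertex :: "((nat \<Rightarrow> real) \<Rightarrow> 'a) \<Rightarrow> nat \<Rightarrow> 'a" where
  "simplex_vertex \<sigma> j = \<sigma> (\<lambda>l. if l = j then 1 else 0)"

lemma simplex_vertex_in:
  assumes "\<sigma> \<in> standard_simplex p \<rightarrow> V" "j \<le> p"
  shows "simplex_vertex \<sigma> j \<in> V"
  using assms by (auto simp: simplex_vertex_def)

lemma simplex_vertex_singular_face:
  assumes "j \<le> p" "k \<le> Suc p"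
  shows "simplex_vertex (singular_face (Suc p) k \<sigma>) j = delete_at k (simplex_vertex \<sigma>) j"
proof -
  have "simplical_face k (\<lambda>l. if l = j then 1 else 0 :: real) =
        (\<lambda>l. if l = (if j < k then j else Suc j) then 1 else 0)"
    by (auto simp: simplical_face_def fun_eq_iff)
  then show ?thesis
    using assms by (simp add: simplex_vertex_def singular_face_def delete_at_def)
qed

lemma sign_changes_cong:
  "(\<And>j. j \<le> i \<Longrightarrow> v j = w j) \<Longrightarrow> sign_changes a i v = sign_changes a i w"
  by (simp add: sign_changes_def)

text \<open>
  The case \<open>g = a i\<close> of the Leibniz rule: the coboundary of the cochain on the left is again a
  product of sign changes, one degree higher.
\<close>
lemma eval_chain_boundary:
  "frag_eval (\<lambda>\<sigma>. sign_changes a i (simplex_vertex \<sigma>) * a i (simplex_vertex \<sigma> i))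
     (chain_boundary (Suc i) c) =
   (-1) ^ i * frag_eval (\<lambda>\<sigma>. sign_changes a (Suc i) (simplex_vertex \<sigma>)) c"
proof -
  have "frag_eval (\<lambda>\<sigma>. sign_changes a i (simplex_vertex \<sigma>) * a i (simplex_vertex \<sigma> i))
     (chain_boundary (Suc i) c) =
     frag_eval (\<lambda>\<sigma>. \<Sum>k\<le>Suc i. (-1) ^ k *
        (sign_changes a i (delete_at k (simplex_vertex \<sigma>)) * a i (delete_at k (simplex_vertex \<sigma>) i))) c"
    unfolding chain_boundary_def frag_eval_extend
    by (auto simp: frag_eval_extend frag_eval_sum frag_eval_cmul simplex_vertex_singular_face
        cong: sign_changes_cong simp del: sum.atMost_Suc intro!: frag_eval_cong sum.cong)
  also have "\<dots> = frag_eval (\<lambda>\<sigma>. (-1) ^ i * sign_changes a (Suc i) (simplex_vertex \<sigma>)) c"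
    unfolding coboundary_sign_changes
    by (simp add: sign_changes_def algebra_simps)
  also have "\<dots> = (-1) ^ i * frag_eval (\<lambda>\<sigma>. sign_changes a (Suc i) (simplex_vertex \<sigma>)) c"
    by (simp add: frag_eval_def sum_distrib_left algebra_simps)
  finally show ?thesis .
qed

text \<open>
  Each factor \<open>a j (v (j + 1)) - a j (v j)\<close> changes sign under \<open>\<nu>\<close>, and the final factor \<open>a i\<close>
  becomes \<open>1 - a i\<close>.
\<close>
lemma eval_chain_map:
  assumes "singular_chain i X c"
    and anti: "\<And>j x. \<lbrakk>j \<le> i; x \<in> topspace X\<rbrakk> \<Longrightarrow> a j (\<nu> x) = 1 - a j x"
  shows "frag_eval (\<lambda>\<sigma>. sign_changes a i (simplex_vertex \<sigma>) * a i (simplex_vertex \<sigma> i)) (chain_map i \<nu> c) =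
    (-1) ^ i * (frag_eval (\<lambda>\<sigma>. sign_changes a i (simplex_vertex \<sigma>)) c -
      frag_eval (\<lambda>\<sigma>. sign_changes a i (simplex_vertex \<sigma>) * a i (simplex_vertex \<sigma> i)) c)"
proof -
  have "frag_eval (\<lambda>\<sigma>. sign_changes a i (simplex_vertex \<sigma>) * a i (simplex_vertex \<sigma> i)) (chain_map i \<nu> c) =
    frag_eval (\<lambda>\<sigma>. (-1) ^ i * (sign_changes a i (simplex_vertex \<sigma>) -
       sign_changes a i (simplex_vertex \<sigma>) * a i (simplex_vertex \<sigma> i))) c"
    unfolding chain_map_def frag_eval_extend comp_def
  proof (rule frag_eval_cong)
    fix \<sigma> assume "\<sigma> \<in> Poly_Mapping.keys c"
    then have \<sigma>: "\<sigma> \<in> standard_simplex i \<rightarrow> topspace X"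
      using assms(1) by (fastforce simp: singular_chain_def singular_simplex_def continuous_map_def)
    have v: "simplex_vertex (simplex_map i \<nu> \<sigma>) j = \<nu> (simplex_vertex \<sigma> j)" if "j \<le> i" for j
      using that by (simp add: simplex_vertex_def simplex_map_def)
    have "sign_changes a i (simplex_vertex (simplex_map i \<nu> \<sigma>)) =
        (\<Prod>j<i. (-1) * (a j (simplex_vertex \<sigma> (Suc j)) - a j (simplex_vertex \<sigma> j)))"
      unfolding sign_changes_def
      by (intro prod.cong refl) (simp add: v anti simplex_vertex_in[OF \<sigma>])
    also have "\<dots> = (-1) ^ i * sign_changes a i (simplex_vertex \<sigma>)"
      unfolding sign_changes_def prod.distrib by simp
    finally show "frag_eval (\<lambda>\<sigma>. sign_changes a i (simplex_vertex \<sigma>) * a i (simplex_vertex \<sigma> i))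
         (frag_of (simplex_map i \<nu> \<sigma>)) =
       (-1) ^ i * (sign_changes a i (simplex_vertex \<sigma>) -
       sign_changes a i (simplex_vertex \<sigma>) * a i (simplex_vertex \<sigma> i))"
      by (simp add: v anti simplex_vertex_in[OF \<sigma>] algebra_simps)
  qed
  also have "\<dots> = (-1) ^ i * (frag_eval (\<lambda>\<sigma>. sign_changes a i (simplex_vertex \<sigma>)) c -
      frag_eval (\<lambda>\<sigma>. sign_changes a i (simplex_vertex \<sigma>) * a i (simplex_vertex \<sigma> i)) c)"
    by (simp add: frag_eval_def sum_distrib_left sum_subtractf algebra_simps)
  finally show ?thesis .
qed

text \<open>
  Evaluating the product of \<open>i\<close> sign changes and \<open>a i\<close> on the boundary of \<open>c (i + 1)\<close> gives,
  up to sign, the count for \<open>c (i + 1)\<close>. By the boundary formula it also equals twice an integer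
  minus the count for \<open>c i\<close>: the values on \<open>c i\<close> and on its image under \<open>\<nu>\<close> involve \<open>a i\<close>
  and \<open>1 - a i\<close>. Hence consecutive counts have the same parity.
\<close>
lemma odd_eval_sign_changes:
  assumes chain: "\<And>i. i \<le> k \<Longrightarrow> singular_chain i X (c i)"
    and c0: "c 0 = frag_of \<sigma>"
    and bd: "\<And>i. i < k \<Longrightarrow>
      chain_boundary (Suc i) (c (Suc i)) = c i - frag_cmul ((-1) ^ i) (chain_map i \<nu> (c i))"
    and anti: "\<And>j x. \<lbrakk>j < k; x \<in> topspace X\<rbrakk> \<Longrightarrow> a j (\<nu> x) = 1 - a j x"
  shows "i \<le> k \<Longrightarrow> odd (frag_eval (\<lambda>\<sigma>. sign_changes a i (simplex_vertex \<sigma>)) (c i))"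
proof (induction i)
  case 0
  show ?case by (simp add: c0 sign_changes_def)
next
  case (Suc i)
  let ?W = "\<lambda>i. frag_eval (\<lambda>\<sigma>. sign_changes a i (simplex_vertex \<sigma>)) (c i)"
  let ?\<alpha> = "\<lambda>\<sigma>. sign_changes a i (simplex_vertex \<sigma>) * a i (simplex_vertex \<sigma> i)"
  have "(-1) ^ i * ?W (Suc i) = frag_eval ?\<alpha> (c i - frag_cmul ((-1) ^ i) (chain_map i \<nu> (c i)))"
    using Suc.prems by (subst bd[symmetric]) (simp_all add: eval_chain_boundary)
  also have "\<dots> = frag_eval ?\<alpha> (c i) - (-1) ^ i * ((-1) ^ i * (?W i - frag_eval ?\<alpha> (c i)))"
    using Suc.prems chain[of i]
    by (simp add: frag_eval_diff frag_eval_cmul eval_chain_map[where X = X] anti)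
  also have "\<dots> = 2 * frag_eval ?\<alpha> (c i) - ?W i"
    by (simp flip: mult.assoc power_mult_distrib)
  finally have "odd ((-1) ^ i * ?W (Suc i))"
    using Suc by simp
  then show ?case by simp
qed

section \<open>Sign changes inside a member of an open cover\<close>

text \<open>
  The signs are chosen so that \<open>c i - (-1) ^ i * \<nu> (c i)\<close> is a cycle once \<open>c i\<close> satisfies the
  formula one degree lower. The vanishing of homology then provides \<open>c (i + 1)\<close>; in degree
  \<open>0\<close> path-connectedness does, by joining the point to its image.
\<close>
lemma equivariant_chains_exist:
  assumes pc: "path_connected_space X" and ne: "topspace X \<noteq> {}"
    and hom: "\<And>p c. \<lbrakk>0 < p; p < k; singular_relcycle p X {} c\<rbrakk> \<Longrightarrow> singular_relboundary p X {} c"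
    and \<nu>: "continuous_map X X \<nu>" and inv: "\<And>x. x \<in> topspace X \<Longrightarrow> \<nu> (\<nu> x) = x"
  shows "\<exists>c \<sigma>. (\<forall>i\<le>k. singular_chain i X (c i)) \<and> c 0 = frag_of \<sigma> \<and>
    (\<forall>i<k. chain_boundary (Suc i) (c (Suc i)) = c i - frag_cmul ((-1) ^ i) (chain_map i \<nu> (c i)))"
proof -
  obtain x where x: "x \<in> topspace X" using ne by blast
  define \<sigma> where "\<sigma> = restrict (\<lambda>y. x) (standard_simplex 0)"
  have \<sigma>: "singular_simplex 0 X \<sigma>"
    by (simp add: singular_simplex_def x \<sigma>_def)
  let ?P = "\<lambda>k c. (\<forall>i\<le>k. singular_chain i X (c i)) \<and> c 0 = frag_of \<sigma> \<and>
    (\<forall>i<k. chain_boundary (Suc i) (c (Suc i)) = c i - frag_cmul ((-1) ^ i) (chain_map i \<nu> (c i)))"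
  have "\<exists>c. ?P l c" if "l \<le> k" for l
    using that
  proof (induction l)
    case 0
    show ?case
      by (rule exI[of _ "\<lambda>_. frag_of \<sigma>"]) (simp add: singular_chain_of \<sigma>)
  next
    case (Suc l)
    then obtain c where c: "?P l c" by auto
    let ?z = "c l - frag_cmul ((-1) ^ l) (chain_map l \<nu> (c l))"
    have cl: "singular_chain l X (c l)" using c by auto
    have \<nu>cl: "singular_chain l X (chain_map l \<nu> (c l))"
      using cl \<nu> by (rule singular_chain_chain_map)
    have z: "singular_chain l X ?z"
      by (intro singular_chain_diff singular_chain_cmul cl \<nu>cl)
    have "singular_relboundary l X {} ?z"
    proof (cases l)
      case 0
      have "singular_simplex 0 X (simplex_map 0 \<nu> \<sigma>)"
        using \<sigma> \<nu> by (rule singular_simplex_simplex_map)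
      then show ?thesis
        using iso_integer_zeroth_homology_group_aux[OF pc \<sigma>] c 0
        by (simp add: homologous_rel_def)
    next
      case l: (Suc p)
      let ?d = "c p" and ?e = "(-1::int) ^ p"
      have d: "singular_chain p X ?d" and bd: "chain_boundary (Suc p) (c l) = ?d - frag_cmul ?e (chain_map p \<nu> ?d)"
        using c l by auto
      have \<nu>\<nu>: "chain_map p \<nu> (chain_map p \<nu> ?d) = ?d"
        using chain_map_id_gen[OF d, of "\<nu> \<circ> \<nu>"] inv by (simp add: chain_map_compose)
      have "chain_boundary l ?z = 
        (?d - frag_cmul ?e (chain_map p \<nu> ?d)) + frag_cmul ?e (chain_map p \<nu> (?d - frag_cmul ?e (chain_map p \<nu> ?d)))"
        using chain_boundary_chain_map[OF cl, of \<nu>] bd l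
        by (simp add: chain_boundary_diff chain_boundary_cmul)
      also have "\<dots> = 0"
        by (rule poly_mapping_eqI)
           (simp add: chain_map_diff \<nu>\<nu> lookup_add lookup_minus right_diff_distrib
             flip: mult.assoc power_mult_distrib)
      finally have "singular_relcycle l X {} ?z"
        using z by (simp add: singular_cycle)
      then show ?thesis
        using hom Suc.prems l by simp
    qed
    then obtain d where d: "singular_chain (Suc l) X d" "chain_boundary (Suc l) d = ?z"
      by (auto simp: singular_boundary)
    show ?case
      by (rule exI[of _ "c(Suc l := d)"]) (use c d in \<open>auto simp: le_Suc_eq less_Suc_eq\<close>)
  qed
  then show ?thesis
    by blast
qed

text \<open>
  A form of the Lusternik-Schnirelmann theorem that refers to arbitrary, possibly discontinuous,
  predicates \<open>P j\<close>. Iterated barycentric subdivision commutes with boundaries and with \<open>\<nu>\<close>, so it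
  preserves the relations between the chains \<open>c i\<close> while making the simplices of \<open>c k\<close> subordinate
  to the cover. Some simplex of the subdivided chain must be counted, as the count is odd.
\<close>
theorem open_cover_sign_changes:
  assumes pc: "path_connected_space X" and ne: "topspace X \<noteq> {}"
    and hom: "\<And>p c. \<lbrakk>0 < p; p < k; singular_relcycle p X {} c\<rbrakk> \<Longrightarrow> singular_relboundary p X {} c"
    and \<nu>: "continuous_map X X \<nu>" and inv: "\<And>x. x \<in> topspace X \<Longrightarrow> \<nu> (\<nu> x) = x"
    and cover: "\<And>U. U \<in> \<C> \<Longrightarrow> openin X U" "topspace X \<subseteq> \<Union>\<C>"
    and anti: "\<And>j x. \<lbrakk>j < k; x \<in> topspace X\<rbrakk> \<Longrightarrow> P j (\<nu> x) \<longleftrightarrow> \<not> P j x"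
  shows "\<exists>V\<in>\<C>. \<exists>v. (\<forall>j\<le>k. v j \<in> V) \<and> (\<forall>j<k. P j (v j) \<noteq> P j (v (Suc j)))"
proof -
  obtain c \<sigma> where c: "\<And>i. i \<le> k \<Longrightarrow> singular_chain i X (c i)" and c0: "c 0 = frag_of \<sigma>"
    and bd: "\<And>i. i < k \<Longrightarrow>
      chain_boundary (Suc i) (c (Suc i)) = c i - frag_cmul ((-1) ^ i) (chain_map i \<nu> (c i))"
    using equivariant_chains_exist[of X k \<nu>] pc ne hom \<nu> inv by blast
  obtain N where N: "\<And>f. f \<in> Poly_Mapping.keys ((singular_subdivision k ^^ N) (c k)) \<Longrightarrow>
      \<exists>V\<in>\<C>. f \<in> standard_simplex k \<rightarrow> V"
    by (rule sufficient_iterated_singular_subdivision_exists[OF cover c[of k]]) auto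
  define d where "d r i = (singular_subdivision i ^^ r) (c i)" for r i
  have d: "(\<forall>i\<le>k. singular_chain i X (d r i)) \<and> d r 0 = frag_of \<sigma> \<and>
    (\<forall>i<k. chain_boundary (Suc i) (d r (Suc i)) = d r i - frag_cmul ((-1) ^ i) (chain_map i \<nu> (d r i)))" for r
  proof (induction r)
    case 0
    show ?case by (simp add: d_def c c0 bd)
  next
    case (Suc r)
    have step: "d (Suc r) i = singular_subdivision i (d r i)" for i
      by (simp add: d_def)
    have cmul: "singular_subdivision i (frag_cmul e b) = frag_cmul e (singular_subdivision i b)" for i e and b :: "'a chain"
      by (simp add: singular_subdivision_def frag_extend_cmul)
    show ?case
    proof (intro conjI allI impI)
      show "singular_chain i X (d (Suc r) i)" if "i \<le> k" for i
        using Suc that by (simp add: step singular_chain_singular_subdivision)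
      have "singular_chain 0 X (d r 0)"
        using Suc by blast
      then show "d (Suc r) 0 = frag_of \<sigma>"
        using Suc by (simp add: step singular_subdivision_zero)
      show "chain_boundary (Suc i) (d (Suc r) (Suc i)) =
          d (Suc r) i - frag_cmul ((-1) ^ i) (chain_map i \<nu> (d (Suc r) i))" if "i < k" for i
        using Suc that chain_boundary_singular_subdivision[of "Suc i" X "d r (Suc i)"]
          naturality_singular_subdivision[of i X "d r i" \<nu>]
        by (simp add: step singular_subdivision_diff cmul)
    qed
  qed
  define a where "a j x = (of_bool (P j x) :: int)" for j x
  have "odd (frag_eval (\<lambda>\<sigma>. sign_changes a k (simplex_vertex \<sigma>)) (d N k))"
    by (rule odd_eval_sign_changes[where X = X and \<nu> = \<nu> and k = k])
       (use d[of N] anti in \<open>auto simp: a_def\<close>)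
  then have "frag_eval (\<lambda>\<sigma>. sign_changes a k (simplex_vertex \<sigma>)) (d N k) \<noteq> 0"
    by (intro notI) simp
  then obtain \<tau> where \<tau>: "\<tau> \<in> Poly_Mapping.keys (d N k)" "sign_changes a k (simplex_vertex \<tau>) \<noteq> 0"
    unfolding frag_eval_def by (elim sum.not_neutral_contains_not_neutral) auto
  then obtain V where V: "V \<in> \<C>" "\<tau> \<in> standard_simplex k \<rightarrow> V"
    using N[of \<tau>] by (auto simp: d_def)
  show ?thesis
  proof (intro bexI exI conjI allI impI)
    show "V \<in> \<C>" by fact
    show "simplex_vertex \<tau> j \<in> V" if "j \<le> k" for j
      using V(2) that by (rule simplex_vertex_in)
    show "P j (simplex_vertex \<tau> j) \<noteq> P j (simplex_vertex \<tau> (Suc j))" if "j < k" for j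
    proof -
      have "a j (simplex_vertex \<tau> (Suc j)) \<noteq> a j (simplex_vertex \<tau> j)"
        using \<tau>(2) that by (auto simp: sign_changes_def)
      then show ?thesis
        by (auto simp: a_def)
    qed
  qed
qed

section \<open>The Borsuk-Ulam theorem\<close>

lemma nsphere_antipode: "x \<in> topspace (nsphere n) \<Longrightarrow> (\<lambda>i. - x i) \<in> topspace (nsphere n)"
  by (simp add: nsphere)

lemma continuous_map_nsphere_antipode:
  "continuous_map (nsphere n) (nsphere n) (\<lambda>x i. - x i)"
proof -
  have "continuous_map (nsphere n) (powertop_real UNIV) (\<lambda>x i. - x i)"
    by (simp add: continuous_map_componentwise_UNIV continuous_map_minus continuous_map_nsphere_projection)
  then show ?thesis
    by (subst (2) nsphere) (auto simp: continuous_map_in_subtopology nsphere)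
qed

text \<open>
  The two closed hemispheres are contractible, and they meet when \<open>n > 0\<close>.
\<close>
lemma path_connected_nsphere:
  assumes "0 < n"
  shows "path_connected_space (nsphere n)"
proof -
  let ?U = "topspace (nsphere n) \<inter> {x. x n \<ge> 0}" and ?L = "topspace (nsphere n) \<inter> {x. x n \<le> 0}"
  have "path_connectedin (nsphere n) ?U" "path_connectedin (nsphere n) ?L"
    using contractible_space_upper_hemisphere[of n n] contractible_space_lower_hemisphere[of n n]
    by (auto simp: path_connectedin_def subtopology_restrict intro: contractible_imp_path_connected_space)
  moreover have "?U \<inter> ?L \<noteq> {}"
    using in_topspace_nsphere[of n] assms by force
  ultimately have "path_connectedin (nsphere n) (?U \<union> ?L)"
    by (rule path_connectedin_Un)
  moreover have "?U \<union> ?L = topspace (nsphere n)"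
    by force
  ultimately show ?thesis
    by (simp add: path_connectedin_topspace)
qed

lemma nsphere_cycle_is_boundary:
  assumes p: "0 < p" "p < n" and c: "singular_relcycle p (nsphere n) {} c"
  shows "singular_relboundary p (nsphere n) {} c"
proof -
  have "reduced_homology_group (int p) (nsphere n) = homology_group (int p) (nsphere n)"
    by (rule un_reduced_homology_group) (use p in simp)
  moreover have "trivial_group (reduced_homology_group (int p) (nsphere n))"
    by (rule reduced_homology_group_nsphere) (use p in simp)
  ultimately have "carrier (homology_group (int p) (nsphere n)) = {singular_relboundary_set p (nsphere n) {}}"
    by (simp add: trivial_group_def)
  moreover have "homologous_rel_set p (nsphere n) {} c \<in> carrier (homology_group (int p) (nsphere n))"
    unfolding carrier_relative_homology_group using c by (intro imageI) simp
  ultimately have "homologous_rel_set p (nsphere n) {} c = singular_relboundary_set p (nsphere n) {}"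
    by (metis singletonD)
  then show ?thesis
    by (simp only: homologous_rel_set_eq_relboundary)
qed

lemma compact_space_nsphere: "compact_space (nsphere n)"
proof -
  let ?S = "{x. (\<Sum>i\<le>n. x i ^ 2) = 1 \<and> (\<forall>i>n. x i = 0)} :: (nat \<Rightarrow> real) set"
  let ?X = "powertop_real UNIV"
  have "compactin ?X ?S"
  proof (rule closed_compactin)
    show "compactin ?X (UNIV \<rightarrow>\<^sub>E {-1..1})"
      by (simp add: compactin_PiE)
    show "?S \<subseteq> UNIV \<rightarrow>\<^sub>E {-1..1}"
    proof
      fix x assume x: "x \<in> ?S"
      have "\<bar>x i\<bar> \<le> 1" for i
      proof (cases "i \<le> n")
        case True
        then have "(x i)\<^sup>2 \<le> (\<Sum>i\<le>n. x i ^ 2)"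
          by (intro member_le_sum) auto
        then show ?thesis
          using x by (simp add: abs_square_le_1)
      qed (use x in auto)
      then show "x \<in> UNIV \<rightarrow>\<^sub>E {-1..1}"
        by (auto simp: PiE_UNIV_domain abs_le_iff minus_le_iff)
    qed
    have eq: "?S = (\<Inter>i \<in> {n<..}. {x \<in> topspace ?X. x i \<in> {0}}) \<inter>
              {x \<in> topspace ?X. (\<Sum>i\<le>n. x i ^ 2) \<in> {1}}"
      by auto
    show "closedin ?X ?S"
      unfolding eq
      by (rule closedin_Int closedin_Inter continuous_map_sum continuous_map_real_pow
             continuous_map_product_projection closedin_continuous_map_preimage | force | clarify)+
  qed
  then show ?thesis
    by (simp add: nsphere compact_space_subtopology)
qed

text \<open>
  A choice of one point from each antipodal pair, used both to break ties of signs oddly and to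
  extend maps oddly.
\<close>
definition lex_positive :: "(nat \<Rightarrow> real) \<Rightarrow> bool" where
  "lex_positive x \<longleftrightarrow> 0 < x (LEAST i. x i \<noteq> 0)"

lemma lex_positive_antipode:
  assumes "x \<in> topspace (nsphere n)"
  shows "lex_positive (\<lambda>i. - x i) \<longleftrightarrow> \<not> lex_positive x"
proof -
  have "\<exists>i. x i \<noteq> 0"
  proof (rule ccontr)
    assume "\<not> ?thesis"
    then show False
      using assms by (simp add: nsphere)
  qed
  then have "x (LEAST i. x i \<noteq> 0) \<noteq> 0"
    by (rule LeastI_ex)
  then show ?thesis
    by (auto simp: lex_positive_def)
qed

text \<open>
  If \<open>f\<close> has no zero, then the open sets on which one coordinate \<open>f j\<close> has constant strict sign
  cover the sphere. On such a set the sign of \<open>f j\<close> cannot change between the points number \<open>j\<close>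
  and \<open>j + 1\<close>, contrary to \<open>open_cover_sign_changes\<close>.
\<close>
theorem Borsuk_Ulam:
  fixes f :: "(nat \<Rightarrow> real) \<Rightarrow> nat \<Rightarrow> real"
  assumes cont: "\<And>j. j < k \<Longrightarrow> continuous_map (nsphere k) euclideanreal (\<lambda>x. f x j)"
    and odd: "\<And>x j. \<lbrakk>x \<in> topspace (nsphere k); j < k\<rbrakk> \<Longrightarrow> f (\<lambda>i. - x i) j = - f x j"
  shows "\<exists>x \<in> topspace (nsphere k). \<forall>j<k. f x j = 0"
proof (cases "k = 0")
  case True
  then show ?thesis
    using in_topspace_nsphere by blast
next
  case False
  show ?thesis
  proof (rule ccontr)
    assume no_zero: "\<not> ?thesis"
    let ?S = "topspace (nsphere k)"
    define U where "U j s = {x \<in> ?S. s * f x j \<in> {0<..}}" for j and s :: real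
    define C where "C = {U j s | j s. j < k}"
    define P where "P j x \<longleftrightarrow> f x j > 0 \<or> f x j = 0 \<and> lex_positive x" for j x
    have "openin (nsphere k) (U j s)" if "j < k" for j s
      unfolding U_def using cont[OF that]
      by (intro openin_continuous_map_preimage[where Y = euclideanreal] continuous_map_real_mult) auto
    then have op: "openin (nsphere k) V" if "V \<in> C" for V
      using that by (auto simp: C_def)
    have cov: "?S \<subseteq> \<Union>C"
    proof
      fix x assume x: "x \<in> ?S"
      then obtain j where j: "j < k" "f x j \<noteq> 0"
        using no_zero by blast
      then have "x \<in> U j (f x j)"
        using x by (auto simp: U_def zero_less_mult_iff)
      then show "x \<in> \<Union>C"
        using j by (auto simp: C_def)
    qed
    have anti: "P j (\<lambda>i. - x i) \<longleftrightarrow> \<not> P j x" if "j < k" "x \<in> ?S" for j x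
      using that odd[of x j] lex_positive_antipode[of x k] by (auto simp: P_def)
    have ne: "?S \<noteq> {}"
      using in_topspace_nsphere by blast
    have "\<exists>V\<in>C. \<exists>v. (\<forall>j\<le>k. v j \<in> V) \<and> (\<forall>j<k. P j (v j) \<noteq> P j (v (Suc j)))"
    proof (rule open_cover_sign_changes)
      show "path_connected_space (nsphere k)"
        using False by (simp add: path_connected_nsphere)
      show "singular_relboundary p (nsphere k) {} c"
        if "0 < p" "p < k" "singular_relcycle p (nsphere k) {} c" for p c
        using that by (rule nsphere_cycle_is_boundary)
      show "continuous_map (nsphere k) (nsphere k) (\<lambda>x i. - x i)"
        by (rule continuous_map_nsphere_antipode)
    qed (fact ne op cov anti | simp)+
    then obtain V v where V: "V \<in> C" and v: "\<And>j. j \<le> k \<Longrightarrow> v j \<in> V"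
      and change: "\<And>j. j < k \<Longrightarrow> P j (v j) \<noteq> P j (v (Suc j))"
      by blast
    from V obtain j s where j: "j < k" "V = U j s"
      by (auto simp: C_def)
    have "P j x \<longleftrightarrow> 0 < s" if "x \<in> V" for x
      using that by (auto simp: j P_def U_def zero_less_mult_iff)
    then have "P j (v j) = P j (v (Suc j))"
      using v[of j] v[of "Suc j"] j(1) by simp
    then show False
      using change[OF j(1)] by simp
  qed
qed

section \<open>Unit vectors with large pairwise inner products\<close>

text \<open>
  Suppose that the combination vanishes, and let \<open>M\<close> be the sum of the matrices
  \<open>w p * (v p) (v p)\<^sup>T\<close>. It has trace \<open>W = \<Sum> w p\<close> and size \<open>m + 1 = N\<close>, so the sum of the squares of its
  entries is at least \<open>W\<^sup>2 / N\<close>; it is also the sum of all \<open>(g p q)\<^sup>2\<close> with weights \<open>w p * w q\<close>,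
  where \<open>g p q\<close> is the inner product of \<open>v p\<close> and \<open>v q\<close>. The sum of all \<open>g p q\<close> with these weights vanishes.
  As \<open>g p q\<close> lies between \<open>- 1 / N\<close> and \<open>1\<close>, the product \<open>(g p q + 1 / N) * (1 - g p q)\<close> is
  nonnegative, but its weighted sum is at most \<open>0\<close>. So all factors \<open>1 - g p q\<close> vanish, the vectors
  coincide, and their positive combination is not zero after all.
\<close>
lemma positive_combination_nonzero:
  fixes v :: "'a \<Rightarrow> nat \<Rightarrow> real"
  assumes "finite A" "A \<noteq> {}" and w: "\<And>p. p \<in> A \<Longrightarrow> 0 < w p"
    and unit: "\<And>p. p \<in> A \<Longrightarrow> (\<Sum>i\<le>m. (v p i)\<^sup>2) = 1"
    and wide: "\<And>p q. \<lbrakk>p \<in> A; q \<in> A\<rbrakk> \<Longrightarrow> - 1 / (real m + 1) < (\<Sum>i\<le>m. v p i * v q i)"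
  shows "\<exists>i\<le>m. (\<Sum>p\<in>A. w p * v p i) \<noteq> 0"
proof (rule ccontr)
  assume "\<not> ?thesis"
  then have zero: "(\<Sum>p\<in>A. w p * v p i) = 0" if "i \<le> m" for i
    using that by blast
  define N where "N = real m + 1"
  define g where "g p q = (\<Sum>i\<le>m. v p i * v q i)" for p q
  define W where "W = (\<Sum>p\<in>A. w p)"
  define M where "M i j = (\<Sum>p\<in>A. w p * (v p i * v p j))" for i j
  have N: "N > 0" by (simp add: N_def)
  have W: "W > 0" using assms(1,2) w by (auto simp: W_def intro: sum_pos)
  have g1: "g p q \<le> 1" if "p \<in> A" "q \<in> A" for p q
  proof -
    have "(g p q)\<^sup>2 \<le> 1"
      using Cauchy_Schwarz_ineq_sum[of "v p" "v q" "{..m}"] that unit by (simp add: g_def)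
    then show ?thesis
      by (simp add: abs_square_le_1 abs_le_iff)
  qed
  have sum_g: "(\<Sum>p\<in>A. \<Sum>q\<in>A. w p * w q * g p q) = 0"
  proof -
    have "(\<Sum>p\<in>A. \<Sum>q\<in>A. w p * w q * g p q) = (\<Sum>p\<in>A. \<Sum>q\<in>A. \<Sum>i\<le>m. (w p * v p i) * (w q * v q i))"
      by (simp add: g_def sum_distrib_left mult_ac)
    also have "\<dots> = (\<Sum>i\<le>m. (\<Sum>p\<in>A. w p * v p i) * (\<Sum>q\<in>A. w q * v q i))"
      unfolding sum_product by (subst (2) sum.swap, subst sum.swap) (rule refl)
    also have "\<dots> = 0"
      by (intro sum.neutral) (simp add: zero)
    finally show ?thesis .
  qed
  have "W\<^sup>2 / N \<le> (\<Sum>p\<in>A. \<Sum>q\<in>A. w p * w q * (g p q)\<^sup>2)"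
  proof -
    have "W = (\<Sum>i\<le>m. M i i)"
    proof -
      have "(\<Sum>i\<le>m. M i i) = (\<Sum>p\<in>A. w p * (\<Sum>i\<le>m. (v p i)\<^sup>2))"
        unfolding M_def by (subst sum.swap) (simp add: sum_distrib_left power2_eq_square)
      then show ?thesis
        by (simp add: unit W_def)
    qed
    then have "W\<^sup>2 \<le> (\<Sum>i\<le>m. (M i i)\<^sup>2) * N"
      using sum_squared_le_sum_of_squares[of "\<lambda>i. M i i" "{..m}"] by (simp add: N_def add.commute)
    moreover have "(\<Sum>i\<le>m. (M i i)\<^sup>2) \<le> (\<Sum>i\<le>m. \<Sum>j\<le>m. (M i j)\<^sup>2)"
      by (intro sum_mono member_le_sum) auto
    moreover have "(\<Sum>i\<le>m. \<Sum>j\<le>m. (M i j)\<^sup>2) = (\<Sum>p\<in>A. \<Sum>q\<in>A. w p * w q * (g p q)\<^sup>2)"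
    proof -
      have "(\<Sum>i\<le>m. \<Sum>j\<le>m. (M i j)\<^sup>2) =
          (\<Sum>i\<le>m. \<Sum>j\<le>m. \<Sum>p\<in>A. \<Sum>q\<in>A. w p * w q * ((v p i * v q i) * (v p j * v q j)))"
        unfolding M_def power2_eq_square sum_product by (simp add: mult_ac)
      also have "\<dots> = (\<Sum>p\<in>A. \<Sum>q\<in>A. \<Sum>i\<le>m. \<Sum>j\<le>m. w p * w q * ((v p i * v q i) * (v p j * v q j)))"
        by (subst (2) sum.swap, subst sum.swap, subst (3) sum.swap, subst (2) sum.swap) (rule refl)
      also have "\<dots> = (\<Sum>p\<in>A. \<Sum>q\<in>A. w p * w q * (g p q)\<^sup>2)"
        by (simp only: g_def power2_eq_square sum_product) (simp only: sum_distrib_left)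
      finally show ?thesis .
    qed
    ultimately have "W\<^sup>2 \<le> (\<Sum>p\<in>A. \<Sum>q\<in>A. w p * w q * (g p q)\<^sup>2) * N"
      using N by (smt (verit) mult_right_mono)
    then show ?thesis
      using N by (simp add: divide_le_eq)
  qed
  moreover have "(\<Sum>p\<in>A. \<Sum>q\<in>A. w p * w q * ((g p q + 1 / N) * (1 - g p q))) =
      W\<^sup>2 / N - (\<Sum>p\<in>A. \<Sum>q\<in>A. w p * w q * (g p q)\<^sup>2)"
  proof -
    have "(\<Sum>p\<in>A. \<Sum>q\<in>A. w p * w q * ((g p q + 1 / N) * (1 - g p q))) =
       (\<Sum>p\<in>A. \<Sum>q\<in>A. (1 - 1 / N) * (w p * w q * g p q) + 1 / N * (w p * w q) - w p * w q * (g p q)\<^sup>2)"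
      by (intro sum.cong refl) (simp add: algebra_simps power2_eq_square)
    also have "\<dots> = (1 - 1 / N) * (\<Sum>p\<in>A. \<Sum>q\<in>A. w p * w q * g p q) + 1 / N * (W * W)
        - (\<Sum>p\<in>A. \<Sum>q\<in>A. w p * w q * (g p q)\<^sup>2)"
      unfolding W_def sum_product by (simp only: sum.distrib sum_subtractf sum_distrib_left)
    finally show ?thesis
      by (simp add: sum_g power2_eq_square)
  qed
  ultimately have le0: "(\<Sum>p\<in>A. \<Sum>q\<in>A. w p * w q * ((g p q + 1 / N) * (1 - g p q))) \<le> 0"
    by linarith
  have ge: "0 \<le> w p * w q * ((g p q + 1 / N) * (1 - g p q))" if "p \<in> A" "q \<in> A" for p q
    using w[OF that(1)] w[OF that(2)] g1[OF that] wide[OF that]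
    by (intro mult_nonneg_nonneg) (simp_all add: g_def N_def)
  have "g p q = 1" if "p \<in> A" "q \<in> A" for p q
  proof -
    have "(\<Sum>p\<in>A. \<Sum>q\<in>A. w p * w q * ((g p q + 1 / N) * (1 - g p q))) = 0"
      using le0 ge by (intro antisym sum_nonneg) auto
    then have "w p * w q * ((g p q + 1 / N) * (1 - g p q)) = 0"
      using that \<open>finite A\<close> ge by (subst (asm) sum_nonneg_eq_0_iff; force simp: sum_nonneg sum_nonneg_eq_0_iff)
    then show ?thesis
      using w[OF that(1)] w[OF that(2)] wide[OF that] by (simp add: g_def N_def)
  qed
  then have "(\<Sum>p\<in>A. \<Sum>q\<in>A. w p * w q * g p q) = W * W"
    unfolding W_def sum_product by (intro sum.cong refl) simp
  then show False
    using sum_g W by simp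
qed

section \<open>Discontinuity of odd maps to a sphere of smaller dimension\<close>

lemma geodesic_dist_antipode_left:
  assumes "x \<in> topspace (nsphere n)" "y \<in> topspace (nsphere n)"
  shows "geodesic_dist n (\<lambda>i. - x i) y = pi - geodesic_dist n x y"
  using assms abs_inner_nsphere_le_1[OF assms]
  by (simp add: geodesic_dist_def nsphere_antipode sum_negf arccos_minus abs_le_iff)

lemma geodesic_dist_antipode_right:
  assumes "x \<in> topspace (nsphere n)" "y \<in> topspace (nsphere n)"
  shows "geodesic_dist n x (\<lambda>i. - y i) = pi - geodesic_dist n x y"
  using assms abs_inner_nsphere_le_1[OF assms]
  by (simp add: geodesic_dist_def nsphere_antipode sum_negf arccos_minus abs_le_iff)

lemma geodesic_dist_less_arccos_iff:
  assumes "x \<in> topspace (nsphere n)" "y \<in> topspace (nsphere n)" "\<bar>t\<bar> \<le> 1"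
  shows "geodesic_dist n x y < arccos t \<longleftrightarrow> t < (\<Sum>i\<le>n. x i * y i)"
  using assms abs_inner_nsphere_le_1[OF assms(1,2)]
  by (simp add: geodesic_dist_def arccos_less_mono)

text \<open>
  The quantitative Borsuk-Ulam theorem of Dubins and Schwarz. The map \<open>F\<close> below averages \<open>\<phi>\<close>
  over a finite net \<open>P\<close> that is invariant under \<open>x \<mapsto> - x\<close>, with weights supported on the caps
  of radius \<open>s\<close> around the net points. A zero of \<open>F\<close> expresses \<open>0\<close> as a positive combination of the
  values of \<open>\<phi>\<close> at net points within distance \<open>s\<close> of it, hence within distance \<open>r\<close> of each other.
\<close>
theorem odd_map_discontinuity:
  fixes \<phi> :: "(nat \<Rightarrow> real) \<Rightarrow> nat \<Rightarrow> real"
  assumes maps: "\<phi> \<in> topspace (nsphere (Suc m)) \<rightarrow> topspace (nsphere m)"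
    and odd: "\<And>x i. x \<in> topspace (nsphere (Suc m)) \<Longrightarrow> \<phi> (\<lambda>i. - x i) = (\<lambda>i. - \<phi> x i)"
    and "0 < r"
  shows "\<exists>x \<in> topspace (nsphere (Suc m)). \<exists>y \<in> topspace (nsphere (Suc m)).
    geodesic_dist (Suc m) x y < r \<and> zeta m \<le> geodesic_dist m (\<phi> x) (\<phi> y)"
proof (rule ccontr)
  assume contra: "\<not> ?thesis"
  let ?S = "topspace (nsphere (Suc m))"
  let ?neg = "\<lambda>x i. - x i :: real"
  define inner where "inner x y = (\<Sum>i\<le>Suc m. x i * y i)" for x y :: "nat \<Rightarrow> real"
  \<comment> \<open>The bound by \<open>pi / 2\<close> keeps \<open>s\<close> in the range where \<open>arccos\<close> inverts \<open>cos\<close>.\<close>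
  define s where "s = min (r / 2) (pi / 2)"
  define t where "t = cos s"
  have s: "0 < s" "s \<le> r / 2" "s < pi"
    using \<open>0 < r\<close> pi_gt_zero by (auto simp: s_def min_less_iff_disj)
  have t: "\<bar>t\<bar> \<le> 1" "t < 1" "arccos t = s"
    using s cos_monotone_0_pi[of 0 s] by (auto simp: t_def arccos_cos)
  have cont: "continuous_map (nsphere (Suc m)) euclideanreal (\<lambda>x. inner x p)" for p
    unfolding inner_def
    by (intro continuous_map_sum continuous_map_real_mult continuous_map_nsphere_projection) auto

  define U where "U p = {x \<in> ?S. inner x p \<in> {t<..}}" for p
  have "openin (nsphere (Suc m)) (U p)" for p
    unfolding U_def using cont by (rule openin_continuous_map_preimage) simp
  moreover have "?S \<subseteq> \<Union>(U ` ?S)"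
  proof
    fix x assume x: "x \<in> ?S"
    then have "inner x x = 1"
      by (simp add: inner_def topspace_nsphere_iff power2_eq_square)
    then have "x \<in> U x"
      using x t(2) by (simp add: U_def)
    then show "x \<in> \<Union>(U ` ?S)"
      using x by blast
  qed
  ultimately obtain \<F> where "finite \<F>" "\<F> \<subseteq> U ` ?S" "?S \<subseteq> \<Union>\<F>"
    using compact_space_nsphere[of "Suc m"] unfolding compact_space_alt
    by (elim allE[of _ "U ` ?S"]) auto
  then obtain Q where Q: "finite Q" "Q \<subseteq> ?S" "?S \<subseteq> \<Union>(U ` Q)"
    by (metis finite_subset_image)
  define P where "P = Q \<union> ?neg ` Q"
  have P: "finite P" "P \<subseteq> ?S"
    using Q nsphere_antipode by (auto simp: P_def)
  have negP: "bij_betw ?neg P P"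
    by (rule bij_betw_byWitness[where f' = ?neg]) (auto simp: P_def)

  define w where "w x p = max 0 (inner x p - t)" for x p
  define F where "F x j = (\<Sum>p\<in>P. w x p * \<phi> p j)" for x j
  have "\<exists>x\<in>?S. \<forall>j<Suc m. F x j = 0"
  proof (rule Borsuk_Ulam)
    show "continuous_map (nsphere (Suc m)) euclideanreal (\<lambda>x. F x j)" for j
      unfolding F_def w_def
      by (intro continuous_map_sum continuous_map_real_mult continuous_map_real_max
           continuous_map_diff cont P) auto
    show "F (?neg x) j = - F x j" for x j
    proof -
      \<comment> \<open>The reindexing by \<open>p \<mapsto> - p\<close> is where the symmetry of the net is used.\<close>
      have "F (?neg x) j = (\<Sum>p\<in>P. w (?neg x) (?neg p) * \<phi> (?neg p) j)"
        unfolding F_def using sum.reindex_bij_betw[OF negP, of "\<lambda>p. w (?neg x) p * \<phi> p j"] by simp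
      also have "\<dots> = (\<Sum>p\<in>P. - (w x p * \<phi> p j))"
        using P odd by (intro sum.cong refl) (auto simp: w_def inner_def)
      finally show ?thesis
        by (simp add: F_def sum_negf)
    qed
  qed
  then obtain x where x: "x \<in> ?S" "\<And>j. j \<le> m \<Longrightarrow> F x j = 0"
    by (auto simp: less_Suc_eq_le)
  define A where "A = {p \<in> P. t < inner x p}"
  have A: "finite A" "A \<subseteq> ?S" "A \<noteq> {}"
    using P Q x by (auto simp: A_def U_def P_def)
  have close: "geodesic_dist (Suc m) p q < r" if "p \<in> A" "q \<in> A" for p q
  proof -
    have pq: "p \<in> ?S" "q \<in> ?S"
      using that A by auto
    have "geodesic_dist (Suc m) x p < s" "geodesic_dist (Suc m) x q < s"
      unfolding t(3)[symmetric] using that x(1) pq t(1)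
      by (simp_all add: geodesic_dist_less_arccos_iff A_def inner_def)
    then show ?thesis
      using Metric_space.triangle[OF Metric_space_geodesic pq(1) x(1) pq(2)]
        Metric_space.commute[OF Metric_space_geodesic, of "Suc m" p x] s by linarith
  qed
  have "\<exists>i\<le>m. (\<Sum>p\<in>A. w x p * \<phi> p i) \<noteq> 0"
  proof (rule positive_combination_nonzero)
    show "0 < w x p" if "p \<in> A" for p
      using that by (simp add: A_def w_def)
    show "(\<Sum>i\<le>m. (\<phi> p i)\<^sup>2) = 1" if "p \<in> A" for p
      using that A maps by (auto simp: topspace_nsphere_iff)
    show "- 1 / (real m + 1) < (\<Sum>i\<le>m. \<phi> p i * \<phi> q i)" if "p \<in> A" "q \<in> A" for p q
    proof -
      have pq: "p \<in> ?S" "q \<in> ?S" using that A by auto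
      then have "geodesic_dist m (\<phi> p) (\<phi> q) < zeta m"
        using contra close[OF that] by fastforce
      moreover have "\<bar>- 1 / (real m + 1)\<bar> \<le> 1"
        by simp
      ultimately show ?thesis
        using maps pq unfolding zeta_def by (subst (asm) geodesic_dist_less_arccos_iff) auto
    qed
  qed (use A in auto)
  moreover have "(\<Sum>p\<in>A. w x p * \<phi> p i) = F x i" for i
    unfolding F_def by (rule sum.mono_neutral_left) (use P in \<open>auto simp: A_def w_def\<close>)
  ultimately show False
    using x by auto
qed

section \<open>Distortion and Gromov-Hausdorff distance\<close>

lemma inner_nsphere_mono:
  assumes "x \<in> topspace (nsphere m)" "m \<le> n"
  shows "(\<Sum>i\<le>n. x i * y i) = (\<Sum>i\<le>m. x i * y i)"
  using assms by (intro sum.mono_neutral_right) (auto simp: topspace_nsphere_iff)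

lemma nsphere_mono:
  assumes "x \<in> topspace (nsphere m)" "m \<le> n"
  shows "x \<in> topspace (nsphere n)"
  using assms inner_nsphere_mono[OF assms, of x]
  by (simp add: topspace_nsphere_iff power2_eq_square)

lemma geodesic_dist_mono:
  assumes "x \<in> topspace (nsphere m)" "y \<in> topspace (nsphere m)" "m \<le> n"
  shows "geodesic_dist n x y = geodesic_dist m x y"
  using assms nsphere_mono[OF assms(1,3)] nsphere_mono[OF assms(2,3)]
  by (simp add: geodesic_dist_def inner_nsphere_mono[OF assms(1,3)])

text \<open>
  The odd map \<open>\<psi>\<close> agrees with \<open>\<phi>\<close> on one half of the sphere. Each comparison of distances for
  \<open>\<psi>\<close> is one for \<open>\<phi>\<close> at \<open>\<plusminus> x\<close> and \<open>\<plusminus> y\<close>, because taking one antipode replaces \<open>d\<close> by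
  \<open>pi - d\<close> in both spheres and so leaves the absolute difference unchanged.
\<close>
theorem zeta_le_real_distortion:
  assumes "m < n" and \<phi>: "\<phi> \<in> topspace (nsphere n) \<rightarrow> topspace (nsphere m)"
    and dis: "\<And>x y. \<lbrakk>x \<in> topspace (nsphere n); y \<in> topspace (nsphere n)\<rbrakk> \<Longrightarrow>
      \<bar>geodesic_dist n x y - geodesic_dist m (\<phi> x) (\<phi> y)\<bar> \<le> c"
  shows "zeta m \<le> c"
proof (rule ccontr)
  assume "\<not> ?thesis"
  then have c: "0 < zeta m - c" by simp
  let ?S = "topspace (nsphere (Suc m))" and ?neg = "\<lambda>x i. - x i :: real"
  define \<psi> where "\<psi> x = (if lex_positive x then \<phi> x else ?neg (\<phi> (?neg x)))" for x
  have \<phi>': "\<phi> x \<in> topspace (nsphere m)" if "x \<in> ?S" for x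
    using \<phi> nsphere_mono[OF that, of n] \<open>m < n\<close> by auto
  have dis': "\<bar>geodesic_dist (Suc m) x y - geodesic_dist m (\<phi> x) (\<phi> y)\<bar> \<le> c" if "x \<in> ?S" "y \<in> ?S" for x y
    using dis[of x y] nsphere_mono[OF that(1), of n] nsphere_mono[OF that(2), of n]
      geodesic_dist_mono[OF that, of n] \<open>m < n\<close> by simp
  have maps: "\<psi> \<in> ?S \<rightarrow> topspace (nsphere m)"
    by (auto simp: \<psi>_def \<phi>' nsphere_antipode)
  have odd: "\<psi> (?neg x) = ?neg (\<psi> x)" if "x \<in> ?S" for x
    using that by (simp add: \<psi>_def lex_positive_antipode)
  obtain x y where xy: "x \<in> ?S" "y \<in> ?S" "geodesic_dist (Suc m) x y < zeta m - c"
    "zeta m \<le> geodesic_dist m (\<psi> x) (\<psi> y)"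
    using odd_map_discontinuity[OF maps odd c] by auto
  have "\<bar>geodesic_dist (Suc m) x y - geodesic_dist m (\<psi> x) (\<psi> y)\<bar> \<le> c"
  proof -
    have neg: "?neg x \<in> ?S" "?neg y \<in> ?S"
      using xy(1,2) by (simp_all add: nsphere_antipode)
    note antipode = geodesic_dist_antipode_left geodesic_dist_antipode_right nsphere_antipode
    consider "\<psi> x = \<phi> x" "\<psi> y = \<phi> y" | "\<psi> x = ?neg (\<phi> (?neg x))" "\<psi> y = \<phi> y"
      | "\<psi> x = \<phi> x" "\<psi> y = ?neg (\<phi> (?neg y))"
      | "\<psi> x = ?neg (\<phi> (?neg x))" "\<psi> y = ?neg (\<phi> (?neg y))"
      unfolding \<psi>_def by meson
    then show ?thesis
    proof cases
      case 1
      then show ?thesis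
        using dis'[OF xy(1,2)] by simp
    next
      case 2
      then show ?thesis
        using dis'[OF neg(1) xy(2)] xy(1,2) neg by (simp add: antipode \<phi>' abs_le_iff algebra_simps)
    next
      case 3
      then show ?thesis
        using dis'[OF xy(1) neg(2)] xy(1,2) neg by (simp add: antipode \<phi>' abs_le_iff algebra_simps)
    next
      case 4
      then show ?thesis
        using dis'[OF neg] xy(1,2) neg by (simp add: antipode \<phi>')
    qed
  qed
  then show False
    using xy by simp
qed

lemma mdist_geodesic_sphere_eq: "mdist (geodesic_sphere n) = geodesic_dist n"
  by (simp add: geodesic_sphere_def Metric_space.mdist_metric[OF Metric_space_geodesic])

theorem zeta_le_distortion:
  assumes "m < n" and \<phi>: "\<phi> \<in> mspace (geodesic_sphere n) \<rightarrow> mspace (geodesic_sphere m)"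
  shows "ereal (zeta m) \<le> distortion (geodesic_sphere n) (geodesic_sphere m) \<phi>"
proof (rule ccontr)
  assume "\<not> ?thesis"
  then have "distortion (geodesic_sphere n) (geodesic_sphere m) \<phi> < ereal (zeta m)"
    by simp
  then obtain c where c: "distortion (geodesic_sphere n) (geodesic_sphere m) \<phi> < ereal c"
    "ereal c < ereal (zeta m)"
    using ereal_dense2 by blast
  have "zeta m \<le> c"
  proof (rule zeta_le_real_distortion[OF \<open>m < n\<close>])
    show "\<phi> \<in> topspace (nsphere n) \<rightarrow> topspace (nsphere m)"
      using \<phi> by simp
    fix x y assume xy: "x \<in> topspace (nsphere n)" "y \<in> topspace (nsphere n)"
    have "ereal \<bar>geodesic_dist n x y - geodesic_dist m (\<phi> x) (\<phi> y)\<bar>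
        \<le> distortion (geodesic_sphere n) (geodesic_sphere m) \<phi>"
      unfolding distortion_def mspace_geodesic_sphere mdist_geodesic_sphere_eq
      by (rule SUP_upper2[OF xy(1)]) (rule SUP_upper[OF xy(2)])
    from order_trans[OF this less_imp_le[OF c(1)]]
    show "\<bar>geodesic_dist n x y - geodesic_dist m (\<phi> x) (\<phi> y)\<bar> \<le> c"
      by simp
  qed
  then show False
    using c(2) by simp
qed

text \<open>
  Send each \<open>y\<close> to some \<open>x\<close> with \<open>f x\<close> within \<open>r\<close> of \<open>g y\<close>; by the triangle inequality a distance
  changes by at most \<open>r\<close> at each of its two ends.
\<close>
lemma hausdorff_dist_less_imp_choice:
  assumes f: "isometric_embedding X Z f" and g: "isometric_embedding Y Z g"
    and h: "hausdorff_dist Z (f ` mspace X) (g ` mspace Y) < ereal r"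
  obtains \<phi> where "\<phi> \<in> mspace Y \<rightarrow> mspace X" "distortion Y X \<phi> \<le> ereal (2 * r)"
proof -
  have "\<exists>x\<in>mspace X. mdist Z (f x) (g y) < r" if y: "y \<in> mspace Y" for y
  proof -
    have "(INF a\<in>f ` mspace X. ereal (mdist Z a (g y))) \<le> hausdorff_dist Z (f ` mspace X) (g ` mspace Y)"
      unfolding hausdorff_dist_def using y by (intro max.coboundedI2 SUP_upper) auto
    then have "(INF a\<in>f ` mspace X. ereal (mdist Z a (g y))) < ereal r"
      using h by (rule le_less_trans)
    then show ?thesis
      by (auto simp: INF_less_iff)
  qed
  then obtain \<phi> where \<phi>: "\<And>y. y \<in> mspace Y \<Longrightarrow> \<phi> y \<in> mspace X \<and> mdist Z (f (\<phi> y)) (g y) < r"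
    by metis
  have "\<bar>mdist Y y y' - mdist X (\<phi> y) (\<phi> y')\<bar> \<le> 2 * r" if y: "y \<in> mspace Y" "y' \<in> mspace Y" for y y'
  proof -
    have Z: "f (\<phi> y) \<in> mspace Z" "f (\<phi> y') \<in> mspace Z" "g y \<in> mspace Z" "g y' \<in> mspace Z"
      using f g \<phi> y by (auto simp: isometric_embedding_def)
    have "mdist Y y y' = mdist Z (g y) (g y')" "mdist X (\<phi> y) (\<phi> y') = mdist Z (f (\<phi> y)) (f (\<phi> y'))"
      using f g \<phi> y by (auto simp: isometric_embedding_def)
    then show ?thesis
      using mdist_triangle[OF Z(3,1,4)] mdist_triangle[OF Z(1,2,4)]
        mdist_triangle[OF Z(1,3,2)] mdist_triangle[OF Z(3,4,2)]
        \<phi>[OF y(1)] \<phi>[OF y(2)] mdist_commute[of Z "g y" "f (\<phi> y)"] mdist_commute[of Z "g y'" "f (\<phi> y')"]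
      by linarith
  qed
  then have "distortion Y X \<phi> \<le> ereal (2 * r)"
    unfolding distortion_def by (intro SUP_least) simp
  with \<phi> show thesis
    by (intro that) auto
qed

theorem theorem2:
  fixes m n :: nat
  assumes "0 < m" and "m < n"
  shows "gh_dist (geodesic_sphere m) (geodesic_sphere n) \<ge> ereal (1 / 2 * zeta m) \<and>
    (\<forall>\<phi> \<in> mspace (geodesic_sphere n) \<rightarrow> mspace (geodesic_sphere m).
       distortion (geodesic_sphere n) (geodesic_sphere m) \<phi> \<ge> ereal (zeta m))"
proof (intro conjI ballI)
  show "ereal (zeta m) \<le> distortion (geodesic_sphere n) (geodesic_sphere m) \<phi>"
    if "\<phi> \<in> mspace (geodesic_sphere n) \<rightarrow> mspace (geodesic_sphere m)" for \<phi>
    using \<open>m < n\<close> that by (rule zeta_le_distortion)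
  show "ereal (1 / 2 * zeta m) \<le> gh_dist (geodesic_sphere m) (geodesic_sphere n)"
    unfolding gh_dist_def
  proof (rule Inf_greatest, clarify)
    fix Z :: "((nat \<Rightarrow> real) + (nat \<Rightarrow> real)) metric" and f g
    assume f: "isometric_embedding (geodesic_sphere m) Z f"
      and g: "isometric_embedding (geodesic_sphere n) Z g"
    let ?h = "hausdorff_dist Z (f ` mspace (geodesic_sphere m)) (g ` mspace (geodesic_sphere n))"
    show "ereal (1 / 2 * zeta m) \<le> ?h"
    proof (rule ccontr)
      assume "\<not> ?thesis"
      then have "?h < ereal (1 / 2 * zeta m)"
        by simp
      then obtain r where r: "?h < ereal r" "ereal r < ereal (1 / 2 * zeta m)"
        using ereal_dense2 by blast
      obtain \<phi> where "\<phi> \<in> mspace (geodesic_sphere n) \<rightarrow> mspace (geodesic_sphere m)"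
        "distortion (geodesic_sphere n) (geodesic_sphere m) \<phi> \<le> ereal (2 * r)"
        using f g r(1) by (rule hausdorff_dist_less_imp_choice)
      then have "ereal (zeta m) \<le> ereal (2 * r)"
        using zeta_le_distortion[OF \<open>m < n\<close>] order_trans by blast
      then show False
        using r(2) by simp
    qed
  qed
qed

end
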